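(* Let $R$ be a graded ring, and let $\Theta$ be a graded left $R$-module. Then the functor $H^0_{\overline{\mathrm{dist}\,\Theta}}:\mathrm{gr\,Mod}(R)\to\mathrm{gr\,Mod}(R)$ is left exact.
   Context: Gradings are $\mathbb{Z}$-gradings and modules are left modules; $\mathrm{gr\,Mod}(R)$ is the category of graded left $R$-modules and degree-preserving $R$-linear maps. A homogeneous left ideal of $R$ is strongly $\Theta$-distinguished if it is equal to $\mathrm{ann}_\ell(\theta)=\{r\in R:r\theta=0\}$ for some nonzero homogeneous $\theta\in\Theta$. Let $\overline{\mathrm{dist}\,\Theta}$ be the set of all intersections of finite sets of strongly $\Theta$-distinguished left ideals. For a graded left $R$-module $M$, let $h^0_{\overline{\mathrm{dist}\,\Theta}}(M)$ be the graded subgroup of $M$ generated by all homogeneous elements $m$ such that $Im=0$ for some $I\in\overline{\mathrm{dist}\,\Theta}$, and let $H^0_{\overline{\mathrm{dist}\,\Theta}}(M)$ be the graded $R$-submodule of $M$ generated by $h^0_{\overline{\mathrm{dist}\,\Theta}}(M)$. *)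

theory Defs
  imports "HOL-Algebra.Algebra"
begin

section \<open>Graded rings and graded left modules\<close>

text \<open>
  The \<open>module\<close> locale of HOL-Algebra requires a commutative ring of scalars; the following one has the
  same axioms over an arbitrary (associative, unital) ring. As in HOL-Algebra, the
  multiplicative fields of the record underlying a module carry no meaning.
\<close>

locale left_module = R?: ring R + M?: abelian_group M
  for R :: "('a, 'x) ring_scheme" (structure) and M :: "('a, 'b, 'y) module_scheme" (structure) +
  assumes smult_closed: "\<lbrakk>a \<in> carrier R; x \<in> carrier M\<rbrakk> \<Longrightarrow> a \<odot>\<^bsub>M\<^esub> x \<in> carrier M"
    and smult_l_distr: "\<lbrakk>a \<in> carrier R; b \<in> carrier R; x \<in> carrier M\<rbrakk> \<Longrightarrow>
      (a \<oplus> b) \<odot>\<^bsub>M\<^esub> x = a \<odot>\<^bsub>M\<^esub> x \<oplus>\<^bsub>M\<^esub> b \<odot>\<^bsub>M\<^esub> x"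
    and smult_r_distr: "\<lbrakk>a \<in> carrier R; x \<in> carrier M; y \<in> carrier M\<rbrakk> \<Longrightarrow>
      a \<odot>\<^bsub>M\<^esub> (x \<oplus>\<^bsub>M\<^esub> y) = a \<odot>\<^bsub>M\<^esub> x \<oplus>\<^bsub>M\<^esub> a \<odot>\<^bsub>M\<^esub> y"
    and smult_assoc1: "\<lbrakk>a \<in> carrier R; b \<in> carrier R; x \<in> carrier M\<rbrakk> \<Longrightarrow>
      (a \<otimes> b) \<odot>\<^bsub>M\<^esub> x = a \<odot>\<^bsub>M\<^esub> (b \<odot>\<^bsub>M\<^esub> x)"
    and smult_one: "x \<in> carrier M \<Longrightarrow> \<one> \<odot>\<^bsub>M\<^esub> x = x"

text \<open>\<open>x\<close> is the finite sum of the family \<open>f\<close>, whose \<open>i\<close>-th member lies in \<open>D i\<close>.\<close>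

definition decomposition ::
    "('a, 'x) ring_scheme \<Rightarrow> (int \<Rightarrow> 'a set) \<Rightarrow> 'a \<Rightarrow> (int \<Rightarrow> 'a) \<Rightarrow> bool" where
  "decomposition G D x f \<longleftrightarrow>
     (\<forall>i. f i \<in> D i) \<and> finite {i. f i \<noteq> \<zero>\<^bsub>G\<^esub>} \<and> x = finsum G f {i. f i \<noteq> \<zero>\<^bsub>G\<^esub>}"

text \<open>The additive group of \<open>G\<close> is the internal direct sum of the subgroups \<open>D i\<close>.\<close>

definition grading :: "('a, 'x) ring_scheme \<Rightarrow> (int \<Rightarrow> 'a set) \<Rightarrow> bool" where
  "grading G D \<longleftrightarrow>
     (\<forall>i. additive_subgroup (D i) G) \<and> (\<forall>x \<in> carrier G. \<exists>!f. decomposition G D x f)"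

definition homogeneous_subset :: "('a, 'x) ring_scheme \<Rightarrow> (int \<Rightarrow> 'a set) \<Rightarrow> 'a set \<Rightarrow> bool" where
  "homogeneous_subset G D H \<longleftrightarrow> (\<forall>x \<in> H. \<exists>f. decomposition G (\<lambda>i. D i \<inter> H) x f)"

record 'a graded_ring = "'a ring" +
  rdeg :: "int \<Rightarrow> 'a set"

locale graded_ring = ring R for R :: "'a graded_ring" (structure) +
  assumes rdeg_grading: "grading R (rdeg R)"
    and rdeg_mult: "\<lbrakk>a \<in> rdeg R i; b \<in> rdeg R j\<rbrakk> \<Longrightarrow> a \<otimes> b \<in> rdeg R (i + j)"

record ('a, 'b) graded_module = "('a, 'b) module" +
  mdeg :: "int \<Rightarrow> 'b set"

locale graded_left_module = R?: graded_ring R + left_module R M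
  for R :: "'a graded_ring" (structure) and M :: "('a, 'b) graded_module" (structure) +
  assumes mdeg_grading: "grading M (mdeg M)"
    and mdeg_smult: "\<lbrakk>a \<in> rdeg R i; x \<in> mdeg M j\<rbrakk> \<Longrightarrow> a \<odot>\<^bsub>M\<^esub> x \<in> mdeg M (i + j)"

definition graded_subgroup :: "('a, 'b) graded_module \<Rightarrow> 'b set \<Rightarrow> bool" where
  "graded_subgroup M H \<longleftrightarrow> additive_subgroup H M \<and> homogeneous_subset M (mdeg M) H"

definition graded_submodule :: "'a graded_ring \<Rightarrow> ('a, 'b) graded_module \<Rightarrow> 'b set \<Rightarrow> bool" where
  "graded_submodule R M N \<longleftrightarrow>
     graded_subgroup M N \<and> (\<forall>a \<in> carrier R. \<forall>x \<in> N. a \<odot>\<^bsub>M\<^esub> x \<in> N)"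

definition homogeneous_left_ideal :: "'a graded_ring \<Rightarrow> 'a set \<Rightarrow> bool" where
  "homogeneous_left_ideal R I \<longleftrightarrow>
     additive_subgroup I R \<and> (\<forall>a \<in> carrier R. \<forall>x \<in> I. a \<otimes>\<^bsub>R\<^esub> x \<in> I) \<and>
     homogeneous_subset R (rdeg R) I"


section \<open>The category of graded left modules\<close>

text \<open>
  A morphism is a function on the carrier of its source. It is made \<open>undefined\<close> elsewhere, so that
  equality of morphisms with the same source and target is equality in HOL.
\<close>

definition gr_hom ::
    "'a graded_ring \<Rightarrow> ('a, 'b) graded_module \<Rightarrow> ('a, 'c) graded_module \<Rightarrow> ('b \<Rightarrow> 'c) set" where
  "gr_hom R M N = {f \<in> extensional (carrier M).
     f \<in> hom (add_monoid M) (add_monoid N) \<and>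
     (\<forall>a \<in> carrier R. \<forall>x \<in> carrier M. f (a \<odot>\<^bsub>M\<^esub> x) = a \<odot>\<^bsub>N\<^esub> f x) \<and>
     (\<forall>i. f ` mdeg M i \<subseteq> mdeg N i)}"

definition gr_id :: "('a, 'b) graded_module \<Rightarrow> 'b \<Rightarrow> 'b" where
  "gr_id M = (\<lambda>x \<in> carrier M. x)"

definition gr_comp :: "('a, 'b) graded_module \<Rightarrow> ('c \<Rightarrow> 'd) \<Rightarrow> ('b \<Rightarrow> 'c) \<Rightarrow> 'b \<Rightarrow> 'd" where
  "gr_comp L g f = compose (carrier L) g f"

definition gr_add ::
    "('a, 'b) graded_module \<Rightarrow> ('a, 'c) graded_module \<Rightarrow> ('b \<Rightarrow> 'c) \<Rightarrow> ('b \<Rightarrow> 'c) \<Rightarrow> 'b \<Rightarrow> 'c" where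
  "gr_add M N f g = (\<lambda>x \<in> carrier M. f x \<oplus>\<^bsub>N\<^esub> g x)"

text \<open>Exactness of \<open>0 \<rightarrow> L \<rightarrow> M \<rightarrow> N\<close>, with maps \<open>f\<close> and \<open>g\<close>, in the category of graded left modules.\<close>

definition gr_left_exact_seq ::
    "'a graded_ring \<Rightarrow> ('a, 'b) graded_module \<Rightarrow> ('b \<Rightarrow> 'c) \<Rightarrow> ('a, 'c) graded_module
      \<Rightarrow> ('c \<Rightarrow> 'd) \<Rightarrow> ('a, 'd) graded_module \<Rightarrow> bool" where
  "gr_left_exact_seq R L f M g N \<longleftrightarrow>
     graded_left_module R L \<and> graded_left_module R M \<and> graded_left_module R N \<and>
     f \<in> gr_hom R L M \<and> g \<in> gr_hom R M N \<and>
     a_kernel L M f = {\<zero>\<^bsub>L\<^esub>} \<and> a_kernel M N g = f ` carrier L"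


section \<open>Distinguished ideals and the associated torsion functor\<close>

definition left_annihilator :: "'a graded_ring \<Rightarrow> ('a, 'b) graded_module \<Rightarrow> 'b \<Rightarrow> 'a set" where
  "left_annihilator R M x = {a \<in> carrier R. a \<odot>\<^bsub>M\<^esub> x = \<zero>\<^bsub>M\<^esub>}"

definition strongly_distinguished ::
    "'a graded_ring \<Rightarrow> ('a, 't) graded_module \<Rightarrow> 'a set \<Rightarrow> bool" where
  "strongly_distinguished R \<Theta> I \<longleftrightarrow> homogeneous_left_ideal R I \<and>
     (\<exists>i. \<exists>\<theta> \<in> mdeg \<Theta> i. \<theta> \<noteq> \<zero>\<^bsub>\<Theta>\<^esub> \<and> I = left_annihilator R \<Theta> \<theta>)"

text \<open>The intersection with the carrier makes the intersection of the empty set equal to \<open>R\<close>.\<close>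

definition dist_closure :: "'a graded_ring \<Rightarrow> ('a, 't) graded_module \<Rightarrow> 'a set set" where
  "dist_closure R \<Theta> =
     {carrier R \<inter> \<Inter>F | F. finite F \<and> (\<forall>I \<in> F. strongly_distinguished R \<Theta> I)}"

definition h0 ::
    "'a graded_ring \<Rightarrow> ('a, 't) graded_module \<Rightarrow> ('a, 'b) graded_module \<Rightarrow> 'b set" where
  "h0 R \<Theta> M = \<Inter>{H. graded_subgroup M H \<and>
     {m \<in> \<Union>i. mdeg M i. \<exists>I \<in> dist_closure R \<Theta>. \<forall>a \<in> I. a \<odot>\<^bsub>M\<^esub> m = \<zero>\<^bsub>M\<^esub>} \<subseteq> H}"

definition H0_carrier ::
    "'a graded_ring \<Rightarrow> ('a, 't) graded_module \<Rightarrow> ('a, 'b) graded_module \<Rightarrow> 'b set" where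
  "H0_carrier R \<Theta> M = \<Inter>{N. graded_submodule R M N \<and> h0 R \<Theta> M \<subseteq> N}"

definition H0 ::
    "'a graded_ring \<Rightarrow> ('a, 't) graded_module \<Rightarrow> ('a, 'b) graded_module \<Rightarrow> ('a, 'b) graded_module" where
  "H0 R \<Theta> M = M\<lparr>carrier := H0_carrier R \<Theta> M, mdeg := (\<lambda>i. mdeg M i \<inter> H0_carrier R \<Theta> M)\<rparr>"

definition H0_map ::
    "'a graded_ring \<Rightarrow> ('a, 't) graded_module \<Rightarrow> ('a, 'b) graded_module \<Rightarrow> ('b \<Rightarrow> 'c) \<Rightarrow> 'b \<Rightarrow> 'c" where
  "H0_map R \<Theta> M f = restrict f (H0_carrier R \<Theta> M)"

end

theory Submission
  imports Defs
begin

text \<open>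
  The submodule \<open>H0_carrier R \<Theta> M\<close> is defined as the graded submodule generated by the
  homogeneous elements killed by some finite intersection of annihilators of homogeneous elements of
  \<open>\<Theta>\<close>. The key is that generating adds nothing: it equals the set \<open>torsion R \<Theta> M\<close> of all elements,
  homogeneous or not, that are killed by such an intersection (\<open>H0_carrier_eq_torsion\<close>). Left
  exactness is then immediate. If \<open>f\<close> is an injective morphism and \<open>I\<close> kills \<open>f m\<close>, then
  \<open>f (a \<odot> m) = a \<odot> f m = 0\<close> for all \<open>a \<in> I\<close>, so \<open>I\<close> already kills \<open>m\<close>: torsion is reflected by
  injective morphisms as well as preserved by all morphisms (\<open>gr_hom_torsion_reflect\<close>,
  \<open>gr_hom_torsion\<close>). Hence an element of the torsion of \<open>M\<close> that lies in the kernel of \<open>g\<close>, so in the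
  image of \<open>f\<close>, comes from the torsion of \<open>L\<close>.

  That \<open>torsion R \<Theta> M\<close> is a graded submodule rests on three facts. The family of ideals is closed under
  binary intersection, which gives closure under addition. It is closed under
  \<open>I \<mapsto> {a. a \<otimes> r \<in> I}\<close> for homogeneous \<open>r\<close>, because the annihilator of \<open>\<theta>\<close> is sent to the
  annihilator of \<open>r \<odot> \<theta>\<close>, again homogeneous (\<open>dist_closure_colon\<close>); this gives closure under scalars.
  Finally, its members are homogeneous left ideals, and a homogeneous scalar that kills an element kills
  each component of it, so that components of torsion elements are torsion.
\<close>

section \<open>Decompositions into homogeneous components\<close>

lemma (in abelian_group_hom) hom_finsum:
  assumes "f \<in> A \<rightarrow> carrier G"
  shows "h (finsum G f A) = finsum H (\<lambda>i. h (f i)) A"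
  using assms
  by (induct A rule: infinite_finite_induct) (auto simp: Pi_def)

lemma (in abelian_group) finsum_mem_additive_subgroup:
  assumes "additive_subgroup H G" "f \<in> A \<rightarrow> H"
  shows "finsum G f A \<in> H"
proof -
  interpret additive_subgroup H G by fact
  show ?thesis
    using assms(2)
    by (induct A rule: infinite_finite_induct) (auto simp: Pi_def)
qed

text \<open>Any finite set that contains the support may be used to check a decomposition.\<close>

lemma (in abelian_group) decompositionI:
  assumes "\<And>i. f i \<in> D i" "\<And>i. D i \<subseteq> carrier G" "finite A" "\<And>i. i \<notin> A \<Longrightarrow> f i = \<zero>"
    and "x = finsum G f A"
  shows "decomposition G D x f"
proof -
  have "finsum G f {i. f i \<noteq> \<zero>} = finsum G f A"
    using assms(1-4) by (intro add.finprod_mono_neutral_cong_left) auto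
  moreover have "finite {i. f i \<noteq> \<zero>}"
    using assms(3,4) by (auto intro: finite_subset[of _ A])
  ultimately show ?thesis
    using assms by (simp add: decomposition_def)
qed

lemma grading_subset: "grading G D \<Longrightarrow> D i \<subseteq> carrier G"
  unfolding grading_def by (blast dest: additive_subgroup.a_subset)

lemma grading_zero: "grading G D \<Longrightarrow> \<zero>\<^bsub>G\<^esub> \<in> D i"
  unfolding grading_def by (blast intro: additive_subgroup.zero_closed)

lemma grading_decomposition:
  assumes "grading G D" "x \<in> carrier G"
  obtains f where "decomposition G D x f"
  using assms unfolding grading_def by blast

lemma (in abelian_group) decomposition_unique:
  assumes "grading G D" "decomposition G D x f" "decomposition G D x g"
  shows "f = g"
proof -
  have "x \<in> carrier G"
    using assms(2) grading_subset[OF assms(1)]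
    unfolding decomposition_def by (auto intro!: finsum_closed)
  then show ?thesis
    using assms unfolding grading_def by blast
qed

lemma homogeneous_subset_decomposition:
  assumes "homogeneous_subset G D H" "x \<in> H"
  obtains f where "decomposition G (\<lambda>i. D i \<inter> H) x f"
  using assms unfolding homogeneous_subset_def by blast

lemma (in abelian_group) homogeneous_subset_component:
  assumes "grading G D" "homogeneous_subset G D H" "x \<in> H" "decomposition G D x f"
  shows "f i \<in> H"
proof -
  obtain g where g: "decomposition G (\<lambda>i. D i \<inter> H) x g"
    using assms(2,3) by (rule homogeneous_subset_decomposition)
  then have "decomposition G D x g"
    by (simp add: decomposition_def)
  then have "f = g"
    using assms(1,4) decomposition_unique by blast
  then show ?thesis
    using g by (simp add: decomposition_def)
qed

lemma homogeneous_subsetI: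
  assumes "grading G D" "H \<subseteq> carrier G"
    and "\<And>x f i. x \<in> H \<Longrightarrow> decomposition G D x f \<Longrightarrow> f i \<in> H"
  shows "homogeneous_subset G D H"
  unfolding homogeneous_subset_def
proof
  fix x assume x: "x \<in> H"
  then have "x \<in> carrier G"
    using assms(2) by blast
  with assms(1) obtain f where f: "decomposition G D x f"
    by (rule grading_decomposition)
  then have "decomposition G (\<lambda>i. D i \<inter> H) x f"
    using assms(3)[OF x f] by (simp add: decomposition_def)
  then show "\<exists>f. decomposition G (\<lambda>i. D i \<inter> H) x f" by blast
qed

text \<open>
  Additive maps that shift degrees by \<open>j\<close> carry components to components. The shift is needed
  because the maps of interest are multiplications by homogeneous scalars and evaluations at homogeneous
  elements of a module, of arbitrary degree.
\<close>

lemma (in abelian_group_hom) decomposition_image: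
  fixes j :: int
  assumes D: "grading G D" and E: "grading H E" and shift: "\<And>i. h ` D i \<subseteq> E (i + j)"
    and f: "decomposition G D x f"
  shows "decomposition H E (h x) (\<lambda>k. h (f (k - j)))"
proof (rule H.decompositionI)
  let ?S = "{i. f i \<noteq> \<zero>\<^bsub>G\<^esub>}"
  have f_carrier: "f i \<in> carrier G" for i
    using f grading_subset[OF D] unfolding decomposition_def by blast
  show "h (f (k - j)) \<in> E k" for k
    using f shift[of "k - j"] unfolding decomposition_def by (auto simp: image_subset_iff)
  show "E k \<subseteq> carrier H" for k
    using E by (rule grading_subset)
  show "finite ((\<lambda>i. i + j) ` ?S)"
    using f by (simp add: decomposition_def)
  show "h (f (k - j)) = \<zero>\<^bsub>H\<^esub>" if "k \<notin> (\<lambda>i. i + j) ` ?S" for k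
  proof -
    have "f (k - j) = \<zero>\<^bsub>G\<^esub>"
      using that image_eqI[of k "\<lambda>i. i + j" "k - j" ?S] by auto
    then show ?thesis by simp
  qed
  have "h x = finsum H (\<lambda>i. h (f i)) ?S"
    using f f_carrier hom_finsum[of f ?S] by (simp add: decomposition_def)
  also have "\<dots> = finsum H (\<lambda>k. h (f (k - j))) ((\<lambda>i. i + j) ` ?S)"
    using f_carrier by (subst H.finsum_reindex) (auto simp: inj_on_def)
  finally show "h x = finsum H (\<lambda>k. h (f (k - j))) ((\<lambda>i. i + j) ` ?S)" .
qed

text \<open>
  If \<open>h x = 0\<close>, the images of the components of \<open>x\<close> form a decomposition of zero, and this must be the
  trivial one: kernels of homogeneous maps are homogeneous.
\<close>

lemma (in abelian_group_hom) component_in_kernel: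
  fixes j :: int
  assumes D: "grading G D" and E: "grading H E" and shift: "\<And>i. h ` D i \<subseteq> E (i + j)"
    and f: "decomposition G D x f" and x: "h x = \<zero>\<^bsub>H\<^esub>"
  shows "h (f i) = \<zero>\<^bsub>H\<^esub>"
proof -
  have "decomposition H E \<zero>\<^bsub>H\<^esub> (\<lambda>k. h (f (k - j)))"
    using decomposition_image[OF D E shift f] x by simp
  moreover have "decomposition H E \<zero>\<^bsub>H\<^esub> (\<lambda>k. \<zero>\<^bsub>H\<^esub>)"
    using E by (intro H.decompositionI[where A = "{}"]) (auto simp: grading_zero grading_subset)
  ultimately have "(\<lambda>k. h (f (k - j))) = (\<lambda>k. \<zero>\<^bsub>H\<^esub>)"
    using E H.decomposition_unique by blast
  from fun_cong[OF this, of "i + j"] show ?thesis by simp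
qed


section \<open>Graded modules, graded submodules and their morphisms\<close>

context left_module
begin

lemma smult_left_hom: "a \<in> carrier R \<Longrightarrow> abelian_group_hom M M (\<lambda>x. a \<odot>\<^bsub>M\<^esub> x)"
  by (intro abelian_group_homI group_hom.intro group_hom_axioms.intro M.abelian_group_axioms M.a_group)
     (auto simp: hom_def smult_closed smult_r_distr)

lemma smult_right_hom: "x \<in> carrier M \<Longrightarrow> abelian_group_hom R M (\<lambda>a. a \<odot>\<^bsub>M\<^esub> x)"
  by (intro abelian_group_homI group_hom.intro group_hom_axioms.intro M.abelian_group_axioms M.a_group
        R.abelian_group_axioms R.a_group)
     (auto simp: hom_def smult_closed smult_l_distr)

lemma smult_zero_right: "a \<in> carrier R \<Longrightarrow> a \<odot>\<^bsub>M\<^esub> \<zero>\<^bsub>M\<^esub> = \<zero>\<^bsub>M\<^esub>"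
  using abelian_group_hom.hom_zero[OF smult_left_hom] by simp

end

lemma (in graded_left_module) mdeg_carrier: "x \<in> mdeg M i \<Longrightarrow> x \<in> carrier M"
  using grading_subset[OF mdeg_grading] by blast

lemma (in graded_ring) rdeg_carrier: "a \<in> rdeg R i \<Longrightarrow> a \<in> carrier R"
  using grading_subset[OF rdeg_grading] by blast

text \<open>
  Finite sums in \<open>N\<close> and in \<open>M\<close> are different terms, as the carrier enters into their definition. They
  are compared by applying \<open>hom_finsum\<close> to the inclusion map; decompositions in \<open>N\<close> are then
  decompositions in \<open>M\<close> with components in \<open>N\<close>.
\<close>

lemma (in graded_left_module) graded_left_module_graded_submodule:
  assumes N: "graded_submodule R M N"
  shows "graded_left_module R (M\<lparr>carrier := N, mdeg := \<lambda>i. mdeg M i \<inter> N\<rparr>)"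
    (is "graded_left_module R ?N")
proof -
  interpret N: additive_subgroup N M
    using N by (simp add: graded_submodule_def graded_subgroup_def)
  have hom_N: "homogeneous_subset M (mdeg M) N"
    using N by (simp add: graded_submodule_def graded_subgroup_def)
  interpret N': abelian_group ?N
  proof (rule abelian_groupI)
    fix x assume "x \<in> carrier ?N"
    then show "\<exists>y\<in>carrier ?N. y \<oplus>\<^bsub>?N\<^esub> x = \<zero>\<^bsub>?N\<^esub>"
      by (intro bexI[of _ "\<ominus>\<^bsub>M\<^esub> x"]) (auto simp: M.l_neg)
  qed (auto simp: M.a_assoc intro: M.a_comm)
  interpret inclusion: abelian_group_hom ?N M "\<lambda>x. x"
    by (intro abelian_group_homI group_hom.intro group_hom_axioms.intro M.abelian_group_axioms
          M.a_group N'.abelian_group_axioms N'.a_group) (auto simp: hom_def)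
  have "grading ?N (mdeg ?N)"
    unfolding grading_def
  proof (intro conjI allI ballI)
    fix i
    interpret Mi: additive_subgroup "mdeg M i" M
      using mdeg_grading by (simp add: grading_def)
    have inv: "inv\<^bsub>add_monoid ?N\<^esub> x = \<ominus>\<^bsub>M\<^esub> x" if "x \<in> N" for x
      using inclusion.hom_a_inv[of x] that by (simp add: a_inv_def)
    show "additive_subgroup (mdeg ?N i) ?N"
    proof (intro additive_subgroupI group.subgroupI[OF N'.a_group])
      show "mdeg ?N i \<noteq> {}"
        using Mi.zero_closed N.zero_closed by (auto simp del: Mi.zero_closed N.zero_closed)
      show "inv\<^bsub>add_monoid ?N\<^esub> x \<in> mdeg ?N i" if "x \<in> mdeg ?N i" for x
        using that by (subst inv) auto
    qed auto
  next
    fix x assume "x \<in> carrier ?N"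
    then have "x \<in> N" by simp
    with hom_N obtain f where f: "decomposition M (\<lambda>i. mdeg M i \<inter> N) x f"
      by (rule homogeneous_subset_decomposition)
    have "finsum ?N f {i. f i \<noteq> \<zero>\<^bsub>M\<^esub>} = finsum M f {i. f i \<noteq> \<zero>\<^bsub>M\<^esub>}"
      using f by (intro inclusion.hom_finsum) (auto simp: decomposition_def)
    then have "decomposition ?N (mdeg ?N) x f"
      using f by (simp add: decomposition_def)
    moreover have "g = f" if g: "decomposition ?N (mdeg ?N) x g" for g
    proof -
      have "finsum ?N g {i. g i \<noteq> \<zero>\<^bsub>M\<^esub>} = finsum M g {i. g i \<noteq> \<zero>\<^bsub>M\<^esub>}"
        using g by (intro inclusion.hom_finsum) (auto simp: decomposition_def)
      then have "decomposition M (mdeg M) x g" "decomposition M (mdeg M) x f"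
        using f g by (simp_all add: decomposition_def)
      then show ?thesis
        using mdeg_grading M.decomposition_unique by blast
    qed
    ultimately show "\<exists>!f. decomposition ?N (mdeg ?N) x f"
      by blast
  qed
  moreover have "a \<odot>\<^bsub>M\<^esub> x \<in> N" if "a \<in> carrier R" "x \<in> N" for a x
    using N that by (simp add: graded_submodule_def)
  ultimately show ?thesis
    by unfold_locales
       (auto simp: smult_l_distr smult_r_distr smult_assoc1 smult_one mdeg_smult rdeg_carrier)
qed

lemma gr_homD:
  assumes "graded_left_module R M" "graded_left_module R N" "f \<in> gr_hom R M N"
  shows "abelian_group_hom M N f"
    and "a \<in> carrier R \<Longrightarrow> x \<in> carrier M \<Longrightarrow> f (a \<odot>\<^bsub>M\<^esub> x) = a \<odot>\<^bsub>N\<^esub> f x"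
    and "x \<in> mdeg M i \<Longrightarrow> f x \<in> mdeg N i"
proof -
  interpret M: graded_left_module R M by fact
  interpret N: graded_left_module R N by fact
  show "abelian_group_hom M N f"
    using assms(3)
    by (intro abelian_group_homI group_hom.intro group_hom_axioms.intro M.abelian_group_axioms
          M.M.a_group N.abelian_group_axioms N.M.a_group) (simp add: gr_hom_def)
qed (use assms(3) in \<open>auto simp: gr_hom_def image_subset_iff\<close>)


section \<open>Intersections of annihilators of homogeneous elements\<close>

text \<open>The annihilator of \<open>x\<close> is the kernel of \<open>a \<mapsto> a \<odot> x\<close>, which shifts degrees by that of \<open>x\<close>.\<close>

lemma (in graded_left_module) homogeneous_left_ideal_left_annihilator:
  assumes "x \<in> mdeg M i"
  shows "homogeneous_left_ideal R (left_annihilator R M x)"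
proof -
  have x: "x \<in> carrier M"
    using assms by (rule mdeg_carrier)
  note mult_x = smult_right_hom[OF x]
  have "left_annihilator R M x = a_kernel R M (\<lambda>a. a \<odot>\<^bsub>M\<^esub> x)"
    by (simp add: left_annihilator_def a_kernel_def')
  then have "additive_subgroup (left_annihilator R M x) R"
    using abelian_group_hom.additive_subgroup_a_kernel[OF mult_x] by simp
  moreover have "homogeneous_subset R (rdeg R) (left_annihilator R M x)"
  proof (rule homogeneous_subsetI[OF R.rdeg_grading])
    fix a f k
    assume a: "a \<in> left_annihilator R M x" and f: "decomposition R (rdeg R) a f"
    have "f k \<odot>\<^bsub>M\<^esub> x = \<zero>\<^bsub>M\<^esub>"
      by (rule abelian_group_hom.component_in_kernel[OF mult_x R.rdeg_grading mdeg_grading _ f, where j = i])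
         (use a assms in \<open>auto simp: left_annihilator_def mdeg_smult\<close>)
    moreover have "f k \<in> carrier R"
      using f by (auto simp: decomposition_def intro: R.rdeg_carrier)
    ultimately show "f k \<in> left_annihilator R M x"
      by (simp add: left_annihilator_def)
  qed (auto simp: left_annihilator_def)
  ultimately show ?thesis
    using x by (auto simp: homogeneous_left_ideal_def left_annihilator_def smult_assoc1 smult_zero_right)
qed

lemma dist_closureI:
  "\<lbrakk>finite F; \<And>I. I \<in> F \<Longrightarrow> strongly_distinguished R \<Theta> I\<rbrakk> \<Longrightarrow> carrier R \<inter> \<Inter>F \<in> dist_closure R \<Theta>"
  unfolding dist_closure_def by blast

lemma carrier_in_dist_closure: "carrier R \<in> dist_closure R \<Theta>"
  using dist_closureI[of "{}"] by simp

lemma dist_closure_Int: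
  assumes "I \<in> dist_closure R \<Theta>" "J \<in> dist_closure R \<Theta>"
  shows "I \<inter> J \<in> dist_closure R \<Theta>"
proof -
  obtain F G where FG: "I = carrier R \<inter> \<Inter>F" "J = carrier R \<inter> \<Inter>G" "finite F" "finite G"
    "\<forall>I \<in> F. strongly_distinguished R \<Theta> I" "\<forall>I \<in> G. strongly_distinguished R \<Theta> I"
    using assms unfolding dist_closure_def by blast
  have "I \<inter> J = carrier R \<inter> \<Inter>(F \<union> G)"
    using FG(1,2) by blast
  also have "\<dots> \<in> dist_closure R \<Theta>"
    using FG(3-6) by (intro dist_closureI) auto
  finally show ?thesis .
qed

lemma dist_closure_subset: "I \<in> dist_closure R \<Theta> \<Longrightarrow> I \<subseteq> carrier R"
  unfolding dist_closure_def by auto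

lemma (in graded_ring) dist_closure_homogeneous:
  assumes "I \<in> dist_closure R \<Theta>"
  shows "homogeneous_subset R (rdeg R) I"
proof (rule homogeneous_subsetI[OF rdeg_grading dist_closure_subset[OF assms]])
  fix a f i
  assume a: "a \<in> I" and f: "decomposition R (rdeg R) a f"
  obtain F where F: "I = carrier R \<inter> \<Inter>F" "\<forall>J \<in> F. strongly_distinguished R \<Theta> J"
    using assms unfolding dist_closure_def by blast
  have "f i \<in> J" if "J \<in> F" for J
    using that a F homogeneous_subset_component[OF rdeg_grading _ _ f]
    by (auto simp: strongly_distinguished_def homogeneous_left_ideal_def)
  moreover have "f i \<in> carrier R"
    using f by (auto simp: decomposition_def intro: rdeg_carrier)
  ultimately show "f i \<in> I"
    using F(1) by blast
qed

lemma (in graded_left_module) left_annihilator_smult: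
  assumes "r \<in> carrier R" "x \<in> carrier M"
  shows "left_annihilator R M (r \<odot>\<^bsub>M\<^esub> x) = {a \<in> carrier R. a \<otimes> r \<in> left_annihilator R M x}"
  using assms by (auto simp: left_annihilator_def smult_assoc1)

text \<open>
  Taking the quotient by \<open>r\<close> commutes with intersections and sends the annihilator of \<open>x\<close> to that of
  \<open>r \<odot> x\<close>. If \<open>r \<odot> x = 0\<close>, the result is all of \<open>R\<close>, which annihilates only zero;
  such members are dropped from the intersection.
\<close>

lemma (in graded_left_module) dist_closure_colon:
  assumes r: "r \<in> rdeg R i" and I: "I \<in> dist_closure R M"
  shows "{a \<in> carrier R. a \<otimes> r \<in> I} \<in> dist_closure R M"
proof -
  define colon where "colon J = {a \<in> carrier R. a \<otimes> r \<in> J}" for J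
  have r_carrier: "r \<in> carrier R"
    using r by (rule R.rdeg_carrier)
  obtain F where F: "I = carrier R \<inter> \<Inter>F" "finite F" "\<forall>J \<in> F. strongly_distinguished R M J"
    using I unfolding dist_closure_def by blast
  have "strongly_distinguished R M (colon J)" if J: "J \<in> F" and proper: "colon J \<noteq> carrier R" for J
  proof -
    obtain j x where x: "x \<in> mdeg M j" "J = left_annihilator R M x"
      using F(3) J unfolding strongly_distinguished_def by blast
    have colon: "colon J = left_annihilator R M (r \<odot>\<^bsub>M\<^esub> x)"
      using x r_carrier by (simp add: colon_def left_annihilator_smult mdeg_carrier)
    have rx: "r \<odot>\<^bsub>M\<^esub> x \<in> mdeg M (i + j)"
      using r x by (simp add: mdeg_smult)
    have "r \<odot>\<^bsub>M\<^esub> x \<noteq> \<zero>\<^bsub>M\<^esub>"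
      using proper unfolding colon by (auto simp: left_annihilator_def smult_zero_right)
    then show ?thesis
      using colon rx homogeneous_left_ideal_left_annihilator[OF rx]
      unfolding strongly_distinguished_def by metis
  qed
  moreover have "colon I = carrier R \<inter> \<Inter>(colon ` F - {carrier R})"
    using r_carrier unfolding F(1) colon_def by blast
  ultimately have "colon I \<in> dist_closure R M"
    using F(2) dist_closureI[of "colon ` F - {carrier R}" R M] by auto
  then show ?thesis
    by (simp add: colon_def)
qed


section \<open>The torsion submodule\<close>

text \<open>
  Membership is stated for elements of any degree, so that a member is described by one ideal that
  kills it rather than by a property of each of its components.
\<close>

definition torsion ::
    "'a graded_ring \<Rightarrow> ('a, 't) graded_module \<Rightarrow> ('a, 'b) graded_module \<Rightarrow> 'b set" where
  "torsion R \<Theta> M = {m \<in> carrier M. \<exists>I \<in> dist_closure R \<Theta>. \<forall>a \<in> I. a \<odot>\<^bsub>M\<^esub> m = \<zero>\<^bsub>M\<^esub>}"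

lemma (in graded_left_module) torsion_additive_subgroup:
  "additive_subgroup (torsion R \<Theta> M) M"
proof (intro additive_subgroupI group.subgroupI[OF M.a_group])
  have "\<zero>\<^bsub>M\<^esub> \<in> torsion R \<Theta> M"
    unfolding torsion_def using carrier_in_dist_closure[of R \<Theta>] smult_zero_right by blast
  then show "torsion R \<Theta> M \<noteq> {}" by blast
next
  fix m assume "m \<in> torsion R \<Theta> M"
  then obtain I where I: "m \<in> carrier M" "I \<in> dist_closure R \<Theta>" "\<forall>a \<in> I. a \<odot>\<^bsub>M\<^esub> m = \<zero>\<^bsub>M\<^esub>"
    unfolding torsion_def by blast
  have "a \<odot>\<^bsub>M\<^esub> (\<ominus>\<^bsub>M\<^esub> m) = \<zero>\<^bsub>M\<^esub>" if "a \<in> I" for a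
    using that I dist_closure_subset[OF I(2)] abelian_group_hom.hom_a_inv[OF smult_left_hom, of a m]
    by (auto simp: a_inv_def M.add.inv_one)
  then show "inv\<^bsub>add_monoid M\<^esub> m \<in> torsion R \<Theta> M"
    using I by (auto simp: torsion_def a_inv_def[symmetric])
next
  fix m n assume "m \<in> torsion R \<Theta> M" "n \<in> torsion R \<Theta> M"
  then obtain I J where IJ: "m \<in> carrier M" "I \<in> dist_closure R \<Theta>" "\<forall>a \<in> I. a \<odot>\<^bsub>M\<^esub> m = \<zero>\<^bsub>M\<^esub>"
    "n \<in> carrier M" "J \<in> dist_closure R \<Theta>" "\<forall>a \<in> J. a \<odot>\<^bsub>M\<^esub> n = \<zero>\<^bsub>M\<^esub>"
    unfolding torsion_def by blast
  then have "\<forall>a \<in> I \<inter> J. a \<odot>\<^bsub>M\<^esub> (m \<oplus>\<^bsub>M\<^esub> n) = \<zero>\<^bsub>M\<^esub>"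
    using dist_closure_subset[OF IJ(2)] by (auto simp: smult_r_distr)
  then show "m \<otimes>\<^bsub>add_monoid M\<^esub> n \<in> torsion R \<Theta> M"
    using IJ dist_closure_Int[OF IJ(2,5)] by (auto simp: torsion_def)
qed (auto simp: torsion_def)

text \<open>
  Let \<open>I\<close> kill \<open>m\<close>. A homogeneous element of \<open>I\<close> kills every component of \<open>m\<close>, since multiplication by
  it is a homogeneous map with \<open>m\<close> in its kernel. An arbitrary element of \<open>I\<close> is a sum of
  homogeneous elements of \<open>I\<close>, so it kills every component as well.
\<close>

lemma (in graded_left_module) torsion_homogeneous:
  "homogeneous_subset M (mdeg M) (torsion R \<Theta> M)"
proof (rule homogeneous_subsetI[OF mdeg_grading])
  fix m f i
  assume "m \<in> torsion R \<Theta> M" and f: "decomposition M (mdeg M) m f"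
  then obtain I where m: "m \<in> carrier M" and I: "I \<in> dist_closure R \<Theta>"
    and kill: "\<forall>a \<in> I. a \<odot>\<^bsub>M\<^esub> m = \<zero>\<^bsub>M\<^esub>"
    unfolding torsion_def by blast
  have fi: "f i \<in> carrier M"
    using f by (auto simp: decomposition_def intro: mdeg_carrier)
  have homogeneous_kill: "a \<odot>\<^bsub>M\<^esub> f i = \<zero>\<^bsub>M\<^esub>" if a: "a \<in> rdeg R j" "a \<in> I" for a j
  proof (rule abelian_group_hom.component_in_kernel[OF _ mdeg_grading mdeg_grading _ f])
    show "abelian_group_hom M M (\<lambda>x. a \<odot>\<^bsub>M\<^esub> x)"
      using R.rdeg_carrier[OF a(1)] by (rule smult_left_hom)
    show "(\<lambda>x. a \<odot>\<^bsub>M\<^esub> x) ` mdeg M k \<subseteq> mdeg M (k + j)" for k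
      using mdeg_smult[OF a(1), of _ k] by (auto simp: add.commute)
    show "a \<odot>\<^bsub>M\<^esub> m = \<zero>\<^bsub>M\<^esub>"
      using kill a(2) by blast
  qed
  have "a \<odot>\<^bsub>M\<^esub> f i = \<zero>\<^bsub>M\<^esub>" if a: "a \<in> I" for a
  proof -
    obtain g where g: "decomposition R (\<lambda>j. rdeg R j \<inter> I) a g"
      using R.dist_closure_homogeneous[OF I] a by (rule homogeneous_subset_decomposition)
    have g_mem: "g j \<in> rdeg R j" "g j \<in> I" for j
      using g by (auto simp: decomposition_def)
    have a_sum: "a = finsum R g {j. g j \<noteq> \<zero>}"
      using g by (simp only: decomposition_def)
    have "a \<odot>\<^bsub>M\<^esub> f i = finsum M (\<lambda>j. g j \<odot>\<^bsub>M\<^esub> f i) {j. g j \<noteq> \<zero>}"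
      unfolding a_sum using R.rdeg_carrier[OF g_mem(1)]
      by (intro abelian_group_hom.hom_finsum[OF smult_right_hom[OF fi]] Pi_I)
    also have "\<dots> = \<zero>\<^bsub>M\<^esub>"
      using homogeneous_kill[OF g_mem] by (simp add: M.finsum_zero)
    finally show ?thesis .
  qed
  then show "f i \<in> torsion R \<Theta> M"
    using fi I by (auto simp: torsion_def)
qed (auto simp: torsion_def)

text \<open>
  If \<open>I\<close> kills \<open>m\<close> and \<open>r\<close> is homogeneous, then \<open>{a. a \<otimes> r \<in> I}\<close> kills \<open>r \<odot> m\<close>. A general scalar is a
  finite sum of homogeneous ones, and torsion is closed under finite sums.
\<close>

lemma (in graded_left_module) torsion_graded_submodule:
  assumes "graded_left_module R \<Theta>"
  shows "graded_submodule R M (torsion R \<Theta> M)"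
proof -
  interpret \<Theta>: graded_left_module R \<Theta> by fact
  have homogeneous: "r \<odot>\<^bsub>M\<^esub> m \<in> torsion R \<Theta> M"
    if r: "r \<in> rdeg R i" and m: "m \<in> torsion R \<Theta> M" for r i m
  proof -
    obtain I where I: "m \<in> carrier M" "I \<in> dist_closure R \<Theta>" "\<forall>a \<in> I. a \<odot>\<^bsub>M\<^esub> m = \<zero>\<^bsub>M\<^esub>"
      using m unfolding torsion_def by blast
    have "\<forall>a \<in> {a \<in> carrier R. a \<otimes> r \<in> I}. a \<odot>\<^bsub>M\<^esub> (r \<odot>\<^bsub>M\<^esub> m) = \<zero>\<^bsub>M\<^esub>"
      using I r by (auto simp: smult_assoc1[symmetric] R.rdeg_carrier)
    then show ?thesis
      using \<Theta>.dist_closure_colon[OF r I(2)] I(1) R.rdeg_carrier[OF r]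
      unfolding torsion_def by (blast intro: smult_closed)
  qed
  have "r \<odot>\<^bsub>M\<^esub> m \<in> torsion R \<Theta> M" if r: "r \<in> carrier R" and m: "m \<in> torsion R \<Theta> M" for r m
  proof -
    have m_carrier: "m \<in> carrier M"
      using m by (simp add: torsion_def)
    obtain g where g: "decomposition R (rdeg R) r g"
      using R.rdeg_grading r by (rule grading_decomposition)
    then have g_mem: "g j \<in> rdeg R j" for j
      by (simp add: decomposition_def)
    have r_sum: "r = finsum R g {j. g j \<noteq> \<zero>}"
      using g by (simp only: decomposition_def)
    have "r \<odot>\<^bsub>M\<^esub> m = finsum M (\<lambda>j. g j \<odot>\<^bsub>M\<^esub> m) {j. g j \<noteq> \<zero>}"
      unfolding r_sum using R.rdeg_carrier[OF g_mem]
      by (intro abelian_group_hom.hom_finsum[OF smult_right_hom[OF m_carrier]] Pi_I)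
    also have "\<dots> \<in> torsion R \<Theta> M"
      using homogeneous[OF g_mem m] by (intro M.finsum_mem_additive_subgroup torsion_additive_subgroup) auto
    finally show ?thesis .
  qed
  then show ?thesis
    by (simp add: graded_submodule_def graded_subgroup_def torsion_additive_subgroup torsion_homogeneous)
qed

text \<open>
  The components of a torsion element are homogeneous torsion elements, that is, generators. So torsion
  elements are already sums of generators, before passing to the generated submodule.
\<close>

lemma (in graded_left_module) torsion_subset_h0: "torsion R \<Theta> M \<subseteq> h0 R \<Theta> M"
  unfolding h0_def
proof (intro subsetI InterI, elim CollectE conjE)
  fix m H
  assume m: "m \<in> torsion R \<Theta> M" and H: "graded_subgroup M H"
    and gen: "{m \<in> \<Union>i. mdeg M i. \<exists>I \<in> dist_closure R \<Theta>. \<forall>a \<in> I. a \<odot>\<^bsub>M\<^esub> m = \<zero>\<^bsub>M\<^esub>} \<subseteq> H"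
  obtain f where f: "decomposition M (\<lambda>i. mdeg M i \<inter> torsion R \<Theta> M) m f"
    using torsion_homogeneous m by (rule homogeneous_subset_decomposition)
  have "f i \<in> H" for i
  proof -
    have "f i \<in> mdeg M i" "f i \<in> torsion R \<Theta> M"
      using f by (auto simp: decomposition_def)
    then show ?thesis
      using gen unfolding torsion_def by blast
  qed
  then have "finsum M f {i. f i \<noteq> \<zero>\<^bsub>M\<^esub>} \<in> H"
    using H by (intro M.finsum_mem_additive_subgroup) (auto simp: graded_subgroup_def)
  then show "m \<in> H"
    using f by (simp add: decomposition_def)
qed

lemma (in graded_left_module) H0_carrier_eq_torsion:
  assumes "graded_left_module R \<Theta>"
  shows "H0_carrier R \<Theta> M = torsion R \<Theta> M"
proof
  have sub: "graded_submodule R M (torsion R \<Theta> M)"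
    using assms by (rule torsion_graded_submodule)
  have "{m \<in> \<Union>i. mdeg M i. \<exists>I \<in> dist_closure R \<Theta>. \<forall>a \<in> I. a \<odot>\<^bsub>M\<^esub> m = \<zero>\<^bsub>M\<^esub>} \<subseteq> torsion R \<Theta> M"
    unfolding torsion_def using mdeg_carrier by blast
  with sub have "h0 R \<Theta> M \<subseteq> torsion R \<Theta> M"
    unfolding h0_def graded_submodule_def by (intro Inter_lower CollectI conjI) simp_all
  then show "H0_carrier R \<Theta> M \<subseteq> torsion R \<Theta> M"
    unfolding H0_carrier_def using sub by (intro Inter_lower) simp
  show "torsion R \<Theta> M \<subseteq> H0_carrier R \<Theta> M"
    unfolding H0_carrier_def using torsion_subset_h0 by (intro Inter_greatest) auto
qed


section \<open>Functoriality and left exactness\<close>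

lemma graded_left_module_H0:
  assumes "graded_left_module R \<Theta>" "graded_left_module R M"
  shows "graded_left_module R (H0 R \<Theta> M)"
  using graded_left_module.graded_left_module_graded_submodule[OF assms(2)
      graded_left_module.torsion_graded_submodule[OF assms(2,1)]]
  by (simp add: H0_def graded_left_module.H0_carrier_eq_torsion[OF assms(2,1)])

lemma gr_hom_torsion:
  assumes "graded_left_module R M" "graded_left_module R N" "f \<in> gr_hom R M N"
    and m: "m \<in> torsion R \<Theta> M"
  shows "f m \<in> torsion R \<Theta> N"
proof -
  interpret f: abelian_group_hom M N f
    using assms(1-3) by (rule gr_homD)
  obtain I where I: "m \<in> carrier M" "I \<in> dist_closure R \<Theta>" "\<forall>a \<in> I. a \<odot>\<^bsub>M\<^esub> m = \<zero>\<^bsub>M\<^esub>"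
    using m unfolding torsion_def by blast
  have "a \<odot>\<^bsub>N\<^esub> f m = \<zero>\<^bsub>N\<^esub>" if "a \<in> I" for a
    using that I dist_closure_subset[OF I(2)] gr_homD(2)[OF assms(1-3), of a m] by auto
  then show ?thesis
    using I by (auto simp: torsion_def)
qed

text \<open>The ideal that kills \<open>f m\<close> also kills \<open>m\<close>, by injectivity of \<open>f\<close>.\<close>

lemma gr_hom_torsion_reflect:
  assumes "graded_left_module R M" "graded_left_module R N" "f \<in> gr_hom R M N"
    and ker: "a_kernel M N f = {\<zero>\<^bsub>M\<^esub>}" and m: "m \<in> carrier M" "f m \<in> torsion R \<Theta> N"
  shows "m \<in> torsion R \<Theta> M"
proof -
  interpret M: graded_left_module R M by fact
  obtain I where I: "I \<in> dist_closure R \<Theta>" "\<forall>a \<in> I. a \<odot>\<^bsub>N\<^esub> f m = \<zero>\<^bsub>N\<^esub>"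
    using m(2) unfolding torsion_def by blast
  have "a \<odot>\<^bsub>M\<^esub> m = \<zero>\<^bsub>M\<^esub>" if "a \<in> I" for a
  proof -
    have a: "a \<in> carrier R"
      using that dist_closure_subset[OF I(1)] by blast
    then have "a \<odot>\<^bsub>M\<^esub> m \<in> a_kernel M N f"
      using that I m(1) gr_homD(2)[OF assms(1-3) a m(1)]
      by (simp add: a_kernel_def' M.smult_closed)
    then show ?thesis
      using ker by simp
  qed
  then show ?thesis
    using I(1) m(1) by (auto simp: torsion_def)
qed

lemma H0_map_gr_hom:
  assumes \<Theta>: "graded_left_module R \<Theta>"
    and M: "graded_left_module R M" and N: "graded_left_module R N" and f: "f \<in> gr_hom R M N"
  shows "H0_map R \<Theta> M f \<in> gr_hom R (H0 R \<Theta> M) (H0 R \<Theta> N)"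
proof -
  interpret M: graded_left_module R M by fact
  interpret f: abelian_group_hom M N f
    using M N f by (rule gr_homD)
  note carrier_eq = graded_left_module.H0_carrier_eq_torsion[OF M \<Theta>]
    graded_left_module.H0_carrier_eq_torsion[OF N \<Theta>]
  have sub: "graded_submodule R M (torsion R \<Theta> M)"
    using \<Theta> by (rule M.torsion_graded_submodule)
  interpret T: additive_subgroup "torsion R \<Theta> M" M
    by (rule M.torsion_additive_subgroup)
  have smult: "a \<odot>\<^bsub>M\<^esub> x \<in> torsion R \<Theta> M" if "a \<in> carrier R" "x \<in> torsion R \<Theta> M" for a x
    using sub that by (simp add: graded_submodule_def)
  show ?thesis
    using gr_homD(2,3)[OF M N f] gr_hom_torsion[OF M N f] smult
    by (auto simp: gr_hom_def H0_def H0_map_def carrier_eq hom_def)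
qed

text \<open>
  Restricting to torsion cuts kernels down to their torsion elements. So the claim at \<open>M\<close> is that the
  torsion elements in the image of \<open>f\<close> are the images of the torsion elements of \<open>L\<close>.
\<close>

lemma H0_left_exact:
  assumes \<Theta>: "graded_left_module R \<Theta>" and exact: "gr_left_exact_seq R L f M g N"
  shows "gr_left_exact_seq R (H0 R \<Theta> L) (H0_map R \<Theta> L f) (H0 R \<Theta> M) (H0_map R \<Theta> M g) (H0 R \<Theta> N)"
proof -
  have L: "graded_left_module R L" and M: "graded_left_module R M" and N: "graded_left_module R N"
    and f: "f \<in> gr_hom R L M" and g: "g \<in> gr_hom R M N"
    and ker_f: "a_kernel L M f = {\<zero>\<^bsub>L\<^esub>}" and ker_g: "a_kernel M N g = f ` carrier L"
    using exact unfolding gr_left_exact_seq_def by auto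
  interpret L: graded_left_module R L by fact
  interpret TL: additive_subgroup "torsion R \<Theta> L" L
    by (rule L.torsion_additive_subgroup)
  have carrier_H0: "carrier (H0 R \<Theta> L) = torsion R \<Theta> L" "carrier (H0 R \<Theta> M) = torsion R \<Theta> M"
    and map_f: "H0_map R \<Theta> L f = restrict f (torsion R \<Theta> L)"
    and map_g: "H0_map R \<Theta> M g = restrict g (torsion R \<Theta> M)"
    using graded_left_module.H0_carrier_eq_torsion[OF L \<Theta>]
      graded_left_module.H0_carrier_eq_torsion[OF M \<Theta>]
    by (simp_all add: H0_def H0_map_def)
  have zero_H0: "\<zero>\<^bsub>H0 R \<Theta> L\<^esub> = \<zero>\<^bsub>L\<^esub>" "\<zero>\<^bsub>H0 R \<Theta> M\<^esub> = \<zero>\<^bsub>M\<^esub>" "\<zero>\<^bsub>H0 R \<Theta> N\<^esub> = \<zero>\<^bsub>N\<^esub>"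
    by (simp_all add: H0_def)
  have "a_kernel (H0 R \<Theta> L) (H0 R \<Theta> M) (H0_map R \<Theta> L f) = torsion R \<Theta> L \<inter> a_kernel L M f"
    by (auto simp: a_kernel_def' carrier_H0 map_f zero_H0)
  then have "a_kernel (H0 R \<Theta> L) (H0 R \<Theta> M) (H0_map R \<Theta> L f) = {\<zero>\<^bsub>H0 R \<Theta> L\<^esub>}"
    by (auto simp: ker_f zero_H0)
  moreover have "a_kernel (H0 R \<Theta> M) (H0 R \<Theta> N) (H0_map R \<Theta> M g) = H0_map R \<Theta> L f ` carrier (H0 R \<Theta> L)"
  proof -
    have "a_kernel (H0 R \<Theta> M) (H0 R \<Theta> N) (H0_map R \<Theta> M g) = torsion R \<Theta> M \<inter> a_kernel M N g"
      by (auto simp: a_kernel_def' carrier_H0 map_g zero_H0 torsion_def)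
    also have "\<dots> = torsion R \<Theta> M \<inter> f ` carrier L"
      by (simp add: ker_g)
    also have "\<dots> = f ` torsion R \<Theta> L"
      using gr_hom_torsion[OF L M f, of _ \<Theta>] gr_hom_torsion_reflect[OF L M f ker_f, of _ \<Theta>]
        TL.a_subset by blast
    finally show ?thesis
      by (simp add: carrier_H0 map_f)
  qed
  ultimately show ?thesis
    using L M N f g
    by (simp add: gr_left_exact_seq_def graded_left_module_H0[OF \<Theta>] H0_map_gr_hom[OF \<Theta>])
qed

theorem corollary3p15:
  fixes R :: "'r graded_ring" and \<Theta> :: "('r, 't) graded_module"
  assumes "graded_ring R" and "graded_left_module R \<Theta>"
  shows
    "(\<forall>M :: ('r, 'm) graded_module. graded_left_module R M \<longrightarrow>
        graded_left_module R (H0 R \<Theta> M) \<and>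
        H0_map R \<Theta> M (gr_id M) = gr_id (H0 R \<Theta> M)) \<and>
     (\<forall>(M :: ('r, 'm) graded_module) (N :: ('r, 'n) graded_module).
        graded_left_module R M \<and> graded_left_module R N \<longrightarrow>
        (\<forall>f \<in> gr_hom R M N. H0_map R \<Theta> M f \<in> gr_hom R (H0 R \<Theta> M) (H0 R \<Theta> N)) \<and>
        (\<forall>f \<in> gr_hom R M N. \<forall>g \<in> gr_hom R M N.
           H0_map R \<Theta> M (gr_add M N f g) =
           gr_add (H0 R \<Theta> M) (H0 R \<Theta> N) (H0_map R \<Theta> M f) (H0_map R \<Theta> M g))) \<and>
     (\<forall>(L :: ('r, 'l) graded_module) (M :: ('r, 'm) graded_module) (N :: ('r, 'n) graded_module).
        graded_left_module R L \<and> graded_left_module R M \<and> graded_left_module R N \<longrightarrow>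
        (\<forall>f \<in> gr_hom R L M. \<forall>g \<in> gr_hom R M N.
           H0_map R \<Theta> L (gr_comp L g f) =
           gr_comp (H0 R \<Theta> L) (H0_map R \<Theta> M g) (H0_map R \<Theta> L f))) \<and>
     (\<forall>(L :: ('r, 'l) graded_module) (M :: ('r, 'm) graded_module) (N :: ('r, 'n) graded_module) f g.
        gr_left_exact_seq R L f M g N \<longrightarrow>
        gr_left_exact_seq R (H0 R \<Theta> L) (H0_map R \<Theta> L f) (H0 R \<Theta> M) (H0_map R \<Theta> M g) (H0 R \<Theta> N))"
proof (intro conjI allI impI ballI, goal_cases)
  case (1 M)
  then show ?case
    using assms(2) by (simp add: graded_left_module_H0)
next
  case (2 M)
  then interpret graded_left_module R M by simp
  show ?case
    using H0_carrier_eq_torsion[OF assms(2)]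
    by (auto simp: H0_map_def gr_id_def H0_def torsion_def fun_eq_iff restrict_def)
next
  case (3 M N f)
  then show ?case
    using assms(2) by (simp add: H0_map_gr_hom)
next
  case (4 M N f g)
  then interpret graded_left_module R M by simp
  show ?case
    using H0_carrier_eq_torsion[OF assms(2)]
    by (auto simp: H0_map_def gr_add_def H0_def torsion_def fun_eq_iff restrict_def)
next
  case (5 L M N f g)
  then have L: "graded_left_module R L" and M: "graded_left_module R M" by simp_all
  have "f x \<in> H0_carrier R \<Theta> M" if "x \<in> H0_carrier R \<Theta> L" for x
    using that gr_hom_torsion[OF L M 5(2)]
    by (simp add: graded_left_module.H0_carrier_eq_torsion[OF L assms(2)]
        graded_left_module.H0_carrier_eq_torsion[OF M assms(2)])
  moreover have "H0_carrier R \<Theta> L \<subseteq> carrier L"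
    by (auto simp: graded_left_module.H0_carrier_eq_torsion[OF L assms(2)] torsion_def)
  ultimately show ?case
    by (auto simp: H0_map_def gr_comp_def H0_def compose_def fun_eq_iff restrict_def)
next
  case (6 L M N f g)
  then show ?case
    using assms(2) by (simp add: H0_left_exact)
qed

end
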